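(* Let $K,L\ge0$, let $\alpha_1,\dots,\alpha_K\in\mathbb C$ be distinct, let $\beta_1,\dots,\beta_L$ be distinct nonzero complex numbers not on $\mathbb T$, let $n\ge L$, and let $\Phi_n,\Phi^*_n,\Xi_n,\Xi^*_n$ be the bi-orthogonal system of the weight $$\widehat w(z)=\frac{\prod_{j=1}^K(z-\alpha_j)}{\prod_{j=1}^L(z-\beta_j)}\,w(z).$$ For a sequence $a=(a_m)$ let $$v(a,z)=\big(z^La_{n-L}(z),z^{L-1}a_{n-L+1}(z),\dots,z\,a_{n-1}(z),a_n(z),a_{n+1}(z),\dots,a_{n+K}(z)\big),$$ and let $\det(v_0;\dots;v_N)$ be the determinant with rows $v_0,\dots,v_N$. Then there are constants $C,C^*$ independent of $z$ such that $$\prod_{j=1}^K(z-\alpha_j)\,\Phi_n(z)=C\det\big(v(\phi,z);v(\phi,\alpha_1);\dots;v(\phi,\alpha_K);\beta_1^{-n}v(\xi,\beta_1);\dots;\beta_L^{-n}v(\xi,\beta_L)\big),$$ $$\prod_{j=1}^K(z-\alpha_j)\,\Phi^*_n(z)=C^*\det\big(v(\phi^*,z);v(\phi^*,\alpha_1);\dots;v(\phi^*,\alpha_K);\beta_1^{-n}v(\xi^*,\beta_1);\dots;\beta_L^{-n}v(\xi^*,\beta_L)\big),$$ $$\prod_{j=1}^L(z-\beta_j)\,\Xi_n(z)=C\det\big(v(\xi,z);v(\phi,\alpha_1);\dots;v(\phi,\alpha_K);\beta_1^{-n}v(\xi,\beta_1);\dots;\beta_L^{-n}v(\xi,\beta_L)\big),$$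 $$\prod_{j=1}^L(z-\beta_j)\,\Xi^*_n(z)=C^*\det\big(v(\xi^*,z);v(\phi^*,\alpha_1);\dots;v(\phi^*,\alpha_K);\beta_1^{-n}v(\xi^*,\beta_1);\dots;\beta_L^{-n}v(\xi^*,\beta_L)\big).$$
   Context: $\mathbb T$ is the unit circle. For a complex-valued weight $w$ on $\mathbb T$ put $w_k=\int_{\mathbb T}\frac{d\zeta}{2\pi i\zeta}w(\zeta)\zeta^{-k}$ and $I_n[w]=\det[w_{j-k}]_{j,k=0,\dots,n-1}$, $I_0=1$. If $I_n[w]\ne0$ for all $n\ge0$, the bi-orthogonal system of $w$ is: polynomials $\phi_n,\bar\phi_n$ of degree $n$ with the same leading coefficient $\kappa_n$ satisfying $\int_{\mathbb T}\frac{d\zeta}{2\pi i\zeta}w(\zeta)\phi_m(\zeta)\bar\phi_n(\bar\zeta)=\delta_{m,n}$ with $\bar\zeta=1/\zeta$ ($\bar\phi_n$ is a separate polynomial, not in general the complex conjugate of $\phi_n$; $\kappa_n^2=I_n/I_{n+1}$, with a choice of square root $\kappa_n$ fixed); the reciprocal polynomial $\phi^*_n(z)=z^n\bar\phi_n(1/z)$; and the associated functions, for $z\notin\mathbb T$ and $n>0$, $\xi_n(z)=\int_{\mathbb T}\frac{d\zeta}{2\pi i\zeta}\frac{\zeta+z}{\zeta-z}w(\zeta)\phi_n(\zeta)$, $\ \xi^*_n(z)=-z^n\int_{\mathbb T}\frac{d\zeta}{2\pi i\zeta}\frac{\zeta+z}{\zeta-z}w(\zeta)\bar\phi_n(\bar\zeta)=\frac1{\kappa_n}-\int_{\mathbb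 T}\frac{d\zeta}{2\pi i\zeta}\frac{\zeta+z}{\zeta-z}w(\zeta)\phi^*_n(\zeta)$, and $\xi_0(z)=\kappa_0[w_0+F(z)]$, $\xi^*_0(z)=\kappa_0[w_0-F(z)]$ with $F(z)=\int_{\mathbb T}\frac{d\zeta}{2\pi i\zeta}\frac{\zeta+z}{\zeta-z}w(\zeta)$. Set $r_n=\phi_n(0)/\kappa_n$, $\bar r_n=\bar\phi_n(0)/\kappa_n$. The same definitions and normalisation applied to a modified weight $\widehat w$ give $\Phi_n,\bar\Phi_n,\Phi^*_n,\Xi_n,\Xi^*_n$, leading coefficient $\widehat\kappa_n$, and $\widehat r_n,\widehat{\bar r}_n$. Standing generic assumptions: both the original and the modified bi-orthogonal systems exist, and $r_n\bar r_n\ne0,1$, $\widehat r_n\widehat{\bar r}_n\ne0,1$ for all $n\ge1$. *)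

theory Defs
  imports "HOL-Complex_Analysis.Complex_Analysis" "Jordan_Normal_Form.Determinant"
begin

definition circ_int :: "(complex \<Rightarrow> complex) \<Rightarrow> complex" where
  "circ_int f = contour_integral (circlepath 0 1) (\<lambda>\<zeta>. f \<zeta> / (2 * complex_of_real pi * \<i> * \<zeta>))"

text \<open>A weight is an integrable (not necessarily continuous or positive) function on the circle;
  its values off the circle play no role.\<close>

definition weight :: "(complex \<Rightarrow> complex) \<Rightarrow> bool" where
  "weight w \<longleftrightarrow> (\<lambda>t. w (circlepath 0 1 t)) absolutely_integrable_on {0..1}"

definition fourier_coeff :: "(complex \<Rightarrow> complex) \<Rightarrow> int \<Rightarrow> complex" where
  "fourier_coeff w k = circ_int (\<lambda>\<zeta>. w \<zeta> * \<zeta> powi (- k))"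

definition toeplitz_det :: "(complex \<Rightarrow> complex) \<Rightarrow> nat \<Rightarrow> complex" where
  "toeplitz_det w n = Determinant.det (Matrix.mat n n (\<lambda>(j, k). fourier_coeff w (int j - int k)))"

text \<open>The system is unique up to the sign of each \<open>\<kappa> n\<close>; quantifying over all systems
  amounts to allowing any choice of the square root \<open>\<kappa> n\<close> of
  \<open>toeplitz_det w n / toeplitz_det w (Suc n)\<close>.
  The polynomials \<open>\<phi>b\<close> form the second, independent family; on the circle the
  conjugate of \<open>\<zeta>\<close> is \<open>1 / \<zeta>\<close>.\<close>

definition biorthogonal_system ::
  "(complex \<Rightarrow> complex) \<Rightarrow> (nat \<Rightarrow> complex) \<Rightarrow> (nat \<Rightarrow> complex poly) \<Rightarrow> (nat \<Rightarrow> complex poly) \<Rightarrow> bool"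
where
  "biorthogonal_system w \<kappa> \<phi> \<phi>b \<longleftrightarrow>
     (\<forall>n. toeplitz_det w n \<noteq> 0) \<and>
     (\<forall>n. degree (\<phi> n) = n \<and> degree (\<phi>b n) = n \<and>
          lead_coeff (\<phi> n) = \<kappa> n \<and> lead_coeff (\<phi>b n) = \<kappa> n) \<and>
     (\<forall>m n. circ_int (\<lambda>\<zeta>. w \<zeta> * poly (\<phi> m) \<zeta> * poly (\<phi>b n) (1 / \<zeta>)) = (if m = n then 1 else 0))"

definition generic_system ::
  "(nat \<Rightarrow> complex) \<Rightarrow> (nat \<Rightarrow> complex poly) \<Rightarrow> (nat \<Rightarrow> complex poly) \<Rightarrow> bool" where
  "generic_system \<kappa> \<phi> \<phi>b \<longleftrightarrow>
     (\<forall>n\<ge>1. let r = poly (\<phi> n) 0 / \<kappa> n; rb = poly (\<phi>b n) 0 / \<kappa> n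
            in r * rb \<noteq> 0 \<and> r * rb \<noteq> 1)"

definition poly_fun :: "(nat \<Rightarrow> complex poly) \<Rightarrow> nat \<Rightarrow> complex \<Rightarrow> complex" where
  "poly_fun \<phi> n z = poly (\<phi> n) z"

text \<open>As \<open>\<phi>b n\<close> has degree exactly \<open>n\<close>, this is the polynomial
  \<open>z ^ n * poly (\<phi>b n) (1 / z)\<close>, with the correct value also at \<open>z = 0\<close>.\<close>

definition recip_fun :: "(nat \<Rightarrow> complex poly) \<Rightarrow> nat \<Rightarrow> complex \<Rightarrow> complex" where
  "recip_fun \<phi>b n z = poly (reflect_poly (\<phi>b n)) z"

definition herglotz :: "(complex \<Rightarrow> complex) \<Rightarrow> complex \<Rightarrow> complex" where
  "herglotz f z = circ_int (\<lambda>\<zeta>. (\<zeta> + z) / (\<zeta> - z) * f \<zeta>)"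

definition assoc_fun ::
  "(complex \<Rightarrow> complex) \<Rightarrow> (nat \<Rightarrow> complex) \<Rightarrow> (nat \<Rightarrow> complex poly) \<Rightarrow> nat \<Rightarrow> complex \<Rightarrow> complex"
where
  "assoc_fun w \<kappa> \<phi> n z =
     (if n = 0 then \<kappa> 0 * (fourier_coeff w 0 + herglotz w z)
      else herglotz (\<lambda>\<zeta>. w \<zeta> * poly (\<phi> n) \<zeta>) z)"

definition assoc_recip_fun ::
  "(complex \<Rightarrow> complex) \<Rightarrow> (nat \<Rightarrow> complex) \<Rightarrow> (nat \<Rightarrow> complex poly) \<Rightarrow> nat \<Rightarrow> complex \<Rightarrow> complex"
where
  "assoc_recip_fun w \<kappa> \<phi>b n z =
     (if n = 0 then \<kappa> 0 * (fourier_coeff w 0 - herglotz w z)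
      else - (z ^ n) * herglotz (\<lambda>\<zeta>. w \<zeta> * poly (\<phi>b n) (1 / \<zeta>)) z)"

definition modified_weight ::
  "nat \<Rightarrow> nat \<Rightarrow> (nat \<Rightarrow> complex) \<Rightarrow> (nat \<Rightarrow> complex) \<Rightarrow> (complex \<Rightarrow> complex) \<Rightarrow> complex \<Rightarrow> complex"
where
  "modified_weight K L \<alpha> \<beta> w z = (\<Prod>j=1..K. z - \<alpha> j) / (\<Prod>j=1..L. z - \<beta> j) * w z"

text \<open>Truncated subtraction makes \<open>z ^ (L - i) = 1\<close> for \<open>i \<ge> L\<close>, that is, for the
  entries \<open>a n, \<dots>, a (n + K)\<close>. Only used for \<open>n \<ge> L\<close>.\<close>

definition vrow :: "nat \<Rightarrow> nat \<Rightarrow> nat \<Rightarrow> (nat \<Rightarrow> complex \<Rightarrow> complex) \<Rightarrow> complex \<Rightarrow> complex Matrix.vec" where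
  "vrow K L n a z = Matrix.vec (L + K + 1) (\<lambda>i. z ^ (L - i) * a (n - L + i) z)"

text \<open>The determinant with rows \<open>v(c, z)\<close>, \<open>v(a, \<alpha> j)\<close> and \<open>\<beta> j ^ (-n) v(b, \<beta> j)\<close>.\<close>

definition row_det ::
  "nat \<Rightarrow> nat \<Rightarrow> nat \<Rightarrow> (nat \<Rightarrow> complex) \<Rightarrow> (nat \<Rightarrow> complex) \<Rightarrow>
   (nat \<Rightarrow> complex \<Rightarrow> complex) \<Rightarrow> (nat \<Rightarrow> complex \<Rightarrow> complex) \<Rightarrow> (nat \<Rightarrow> complex \<Rightarrow> complex) \<Rightarrow>
   complex \<Rightarrow> complex"
where
  "row_det K L n \<alpha> \<beta> a b c z =
     Determinant.det (mat_of_rows (L + K + 1)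
       (vrow K L n c z
        # map (\<lambda>j. vrow K L n a (\<alpha> j)) [1..<K + 1]
        @ map (\<lambda>j. inverse (\<beta> j ^ n) \<cdot>\<^sub>v vrow K L n b (\<beta> j)) [1..<L + 1]))"

end

theory Submission
  imports Defs
begin

text \<open>
  Both families \<open>\<phi>\<close> and \<open>\<phi>*\<close> are orthogonal families for the moments
  \<open>\<integral> w p \<zeta> ^ (1 - n - s)\<close>, with \<open>s = 0\<close> and \<open>s = 1\<close> respectively, and their associated
  functions are \<open>e z ^ (m + s) \<integral> w a\<^sub>m \<zeta> ^ (1 - m - s) / (\<zeta> - z)\<close> with \<open>e = 2\<close> and \<open>e = - 2\<close>.
  The entries of \<open>v(a, z)\<close> form a basis of the polynomials of degree at most \<open>n + K\<close> subject
  to \<open>\<integral> w p \<zeta> ^ (- j) = 0\<close> for \<open>L + s \<le> j < n + s\<close>, and pairing \<open>v(b, z)\<close> with a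
  coefficient vector gives the Cauchy transform of the corresponding polynomial. The polynomial
  \<open>\<Prod>(z - \<alpha> j) \<Phi> n\<close> lies in this space, vanishes at each \<open>\<alpha> j\<close>, and its Cauchy transform vanishes
  at each \<open>\<beta> j\<close>; uniqueness of \<open>\<Phi> n\<close> makes it the only such polynomial up to scalars. So the
  bordering rows have a one-dimensional kernel and the determinant is proportional to the pairing
  of its first row with the coefficient vector of that polynomial.
\<close>

subsection \<open>Integrals against a weight\<close>

definition wint :: "(complex \<Rightarrow> complex) \<Rightarrow> (complex \<Rightarrow> complex) \<Rightarrow> complex" where
  "wint w g = circ_int (\<lambda>\<zeta>. w \<zeta> * g \<zeta>)"

text \<open>The derivative of the path is 2 pi i times its value, which cancels the normalising
  denominator pointwise, so the identity holds for every \<open>f\<close>, integrable or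
  not.\<close>

lemma circ_int_integral: "circ_int f = integral {0..1} (\<lambda>t. f (circlepath 0 1 t))"
proof -
  have "f (circlepath 0 1 x) / (2 * complex_of_real pi * \<i> * circlepath 0 1 x)
          * vector_derivative (circlepath 0 1) (at x) = f (circlepath 0 1 x)" for x
    by (simp add: vector_derivative_circlepath) (simp add: circlepath)
  then show ?thesis
    unfolding circ_int_def contour_integral_integral by (intro integral_cong)
qed

lemma circlepath_unit [simp]: "norm (circlepath 0 1 t) = 1"
  by (simp add: circlepath)

text \<open>Comparing whole products lets a factor move between weight and test function.\<close>

lemma wint_cong:
  assumes "\<And>\<zeta>. norm \<zeta> = 1 \<Longrightarrow> w \<zeta> * g \<zeta> = w' \<zeta> * g' \<zeta>"
  shows "wint w g = wint w' g'"
  unfolding wint_def circ_int_integral by (intro integral_cong) (simp add: assms)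

text \<open>Along the path \<open>g\<close> is bounded and measurable, and multiplication by such a
  function preserves absolute integrability.\<close>

lemma absolutely_integrable_weight_mult:
  assumes "weight w" "continuous_on (sphere 0 1) g"
  shows "(\<lambda>t. w (circlepath 0 1 t) * g (circlepath 0 1 t)) absolutely_integrable_on {0..1}"
proof -
  have c: "continuous_on {0..1} (\<lambda>t. g (circlepath 0 1 t))"
    using path_circlepath[of 0 1] unfolding path_def
    by (rule continuous_on_compose2[OF assms(2)]) auto
  from absolutely_integrable_bounded_measurable_product[OF bilinear_times
      continuous_imp_measurable_on_sets_lebesgue[OF c] _ compact_imp_bounded[OF compact_continuous_image[OF c]]
      assms(1)[unfolded weight_def]]
  show ?thesis by (simp add: mult.commute)
qed

lemma integrable_weight_mult:
  assumes "weight w" "continuous_on (sphere 0 1) g"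
  shows "(\<lambda>t. w (circlepath 0 1 t) * g (circlepath 0 1 t)) integrable_on {0..1}"
  using absolutely_integrable_weight_mult[OF assms] absolutely_integrable_on_def by blast

lemma weight_mult:
  assumes "weight w" "continuous_on (sphere 0 1) g"
  shows "weight (\<lambda>\<zeta>. w \<zeta> * g \<zeta>)"
  using absolutely_integrable_weight_mult[OF assms] by (simp add: weight_def)

lemma wint_add:
  assumes "weight w" "continuous_on (sphere 0 1) f" "continuous_on (sphere 0 1) g"
  shows "wint w (\<lambda>\<zeta>. f \<zeta> + g \<zeta>) = wint w f + wint w g"
  unfolding wint_def circ_int_integral distrib_left
  by (intro integral_add integrable_weight_mult assms)

lemma wint_cmult: "wint w (\<lambda>\<zeta>. c * f \<zeta>) = c * wint w f"
proof -
  have "wint w (\<lambda>\<zeta>. c * f \<zeta>) = integral {0..1} (\<lambda>t. c * (w (circlepath 0 1 t) * f (circlepath 0 1 t)))"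
    unfolding wint_def circ_int_integral by (simp add: mult_ac)
  then show ?thesis by (simp add: wint_def circ_int_integral)
qed

section \<open>Moments and Cauchy transforms of polynomials\<close>

definition moment :: "(complex \<Rightarrow> complex) \<Rightarrow> nat \<Rightarrow> complex poly \<Rightarrow> complex" where
  "moment w N p = wint w (\<lambda>\<zeta>. poly p \<zeta> * \<zeta> / \<zeta> ^ N)"

text \<open>The factor \<open>\<zeta>\<close> in the numerator fits the splitting (\<zeta> + z) /
  (\<zeta> - z) = 2 \<zeta> / (\<zeta> - z) - 1 of the Herglotz kernel.\<close>

definition cauchy :: "(complex \<Rightarrow> complex) \<Rightarrow> nat \<Rightarrow> complex poly \<Rightarrow> complex \<Rightarrow> complex" where
  "cauchy w N p z = wint w (\<lambda>\<zeta>. poly p \<zeta> * \<zeta> / (\<zeta> ^ N * (\<zeta> - z)))"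

lemma continuous_on_moment [continuous_intros]:
  "continuous_on (sphere 0 1) (\<lambda>\<zeta> :: complex. poly p \<zeta> * \<zeta> / \<zeta> ^ N)"
  by (intro continuous_intros) auto

lemma continuous_on_cauchy [continuous_intros]:
  assumes "norm (z :: complex) \<noteq> 1"
  shows "continuous_on (sphere 0 1) (\<lambda>\<zeta>. poly p \<zeta> * \<zeta> / (\<zeta> ^ N * (\<zeta> - z)))"
  using assms by (intro continuous_intros) auto

lemma moment_smult: "moment w N (Polynomial.smult c p) = c * moment w N p"
  unfolding moment_def wint_cmult[symmetric] by (rule wint_cong) simp

lemma moment_add:
  assumes "weight w" shows "moment w N (p + q) = moment w N p + moment w N q"
  unfolding moment_def
  by (subst wint_add[symmetric]) (auto intro!: assms continuous_intros wint_cong simp: field_simps add_divide_distrib)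

lemma moment_0 [simp]: "moment w N 0 = 0"
  using moment_smult[of w N 0 0] by simp

lemma moment_diff:
  assumes "weight w" shows "moment w N (p - q) = moment w N p - moment w N q"
  using moment_add[OF assms, of N "p - q" q] by simp

lemma moment_sum:
  assumes "weight w"
  shows "moment w N (\<Sum>i\<in>J. Polynomial.smult (c i) (p i)) = (\<Sum>i\<in>J. c i * moment w N (p i))"
  by (induction J rule: infinite_finite_induct) (simp_all add: moment_add[OF assms] moment_smult)

lemma moment_monom_mult: "moment w (N + k) (monom 1 k * p) = moment w N p"
  unfolding moment_def by (rule wint_cong) (auto simp: poly_monom power_add)

lemma cauchy_smult: "cauchy w N (Polynomial.smult c p) z = c * cauchy w N p z"
  unfolding cauchy_def wint_cmult[symmetric] by (rule wint_cong) simp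

lemma cauchy_add:
  assumes "weight w" "norm z \<noteq> 1"
  shows "cauchy w N (p + q) z = cauchy w N p z + cauchy w N q z"
  unfolding cauchy_def using assms
  by (subst wint_add[symmetric]) (auto intro!: continuous_intros wint_cong simp: field_simps add_divide_distrib)

lemma cauchy_monom_mult: "cauchy w (N + k) (monom 1 k * p) z = cauchy w N p z"
  unfolding cauchy_def by (rule wint_cong) (auto simp: poly_monom power_add)

text \<open>The factor cancels the pole of the kernel. Vanishing of a Cauchy transform at a point
  thus becomes a moment condition on the quotient by the linear factor.\<close>

lemma cauchy_linear_factor:
  assumes "norm z \<noteq> 1"
  shows "cauchy w N ([:-z, 1:] * p) z = moment w N p"
proof -
  have "poly ([:-z, 1:] * p) \<zeta> * \<zeta> / (\<zeta> ^ N * (\<zeta> - z)) = poly p \<zeta> * \<zeta> / \<zeta> ^ N"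
    if "norm \<zeta> = 1" for \<zeta>
  proof -
    have "\<zeta> - z \<noteq> 0" using that assms by auto
    moreover have "poly ([:-z, 1:] * p) \<zeta> = (\<zeta> - z) * poly p \<zeta>" by (simp add: algebra_simps)
    ultimately show ?thesis by simp
  qed
  then show ?thesis unfolding cauchy_def moment_def by (intro wint_cong) simp
qed

text \<open>Write \<open>q\<close> as its value at \<open>z\<close> plus a multiple of the linear
  factor, and cancel that factor against the kernel. When \<open>p\<close> is orthogonal to the
  quotient, \<open>q\<close> comes out of the transform as a scalar.\<close>

lemma cauchy_mult:
  assumes "weight w" "norm z \<noteq> 1"
  shows "cauchy w N (p * q) z = poly q z * cauchy w N p z + moment w N (p * synthetic_div q z)"
proof -
  have "p * q = Polynomial.smult (poly q z) p + [:-z, 1:] * (p * synthetic_div q z)"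
    by (subst synthetic_div_correct'[of z q, symmetric]) (simp add: algebra_simps)
  then have "cauchy w N (p * q) z
      = cauchy w N (Polynomial.smult (poly q z) p) z + cauchy w N ([:-z, 1:] * (p * synthetic_div q z)) z"
    using cauchy_add[OF assms] by metis
  then show ?thesis by (simp only: cauchy_smult cauchy_linear_factor[OF assms(2)])
qed

lemma cauchy_sum:
  assumes "weight w" "norm z \<noteq> 1"
  shows "cauchy w N (\<Sum>i<(D::nat). Polynomial.smult (c i) (p i)) z = (\<Sum>i<D. c i * cauchy w N (p i) z)"
proof (induction D)
  case 0
  show ?case using cauchy_smult[of w N 0 0 z] by simp
next
  case (Suc D)
  then show ?case by (simp add: cauchy_add[OF assms] cauchy_smult)
qed

text \<open>Used with the numerator and the denominator of the modifying factor as \<open>P\<close>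
  and \<open>Q\<close>. The determinant formula sees the relation between the two weights only in
  this cleared form, here and in \<open>cauchy_transfer\<close>.\<close>

lemma moment_transfer:
  assumes "\<And>\<zeta>. norm \<zeta> = 1 \<Longrightarrow> w \<zeta> * poly P \<zeta> = w' \<zeta> * poly Q \<zeta>"
  shows "moment w N (P * p) = moment w' N (Q * p)"
proof -
  have "w \<zeta> * (poly P \<zeta> * poly p \<zeta> * \<zeta> / \<zeta> ^ N) = w' \<zeta> * (poly Q \<zeta> * poly p \<zeta> * \<zeta> / \<zeta> ^ N)"
    if "norm \<zeta> = 1" for \<zeta>
    using arg_cong[OF assms[OF that], of "\<lambda>x. x * (poly p \<zeta> * \<zeta> / \<zeta> ^ N)"] by (simp add: mult_ac)
  then show ?thesis
    unfolding moment_def by (intro wint_cong) simp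
qed

lemma cauchy_transfer:
  assumes "\<And>\<zeta>. norm \<zeta> = 1 \<Longrightarrow> w \<zeta> * poly P \<zeta> = w' \<zeta> * poly Q \<zeta>"
  shows "cauchy w N (P * p) z = cauchy w' N (Q * p) z"
proof -
  have "w \<zeta> * (poly P \<zeta> * poly p \<zeta> * \<zeta> / (\<zeta> ^ N * (\<zeta> - z)))
      = w' \<zeta> * (poly Q \<zeta> * poly p \<zeta> * \<zeta> / (\<zeta> ^ N * (\<zeta> - z)))"
    if "norm \<zeta> = 1" for \<zeta>
    using arg_cong[OF assms[OF that], of "\<lambda>x. x * (poly p \<zeta> * \<zeta> / (\<zeta> ^ N * (\<zeta> - z)))"] by (simp add: mult_ac)
  then show ?thesis
    unfolding cauchy_def by (intro wint_cong) simp
qed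

subsection \<open>Bordered determinants\<close>

text \<open>Laplace expansion along the first row: its cofactors do not see that row, so those of
  the matrix bordered by the zero row serve for every \<open>x\<close>.\<close>

lemma det_border_linear:
  fixes R :: "complex Matrix.vec list"
  assumes "length R = N"
  shows "\<exists>F. \<forall>x. dim_vec x = Suc N \<longrightarrow>
    Determinant.det (mat_of_rows (Suc N) (x # R)) = (\<Sum>j<Suc N. vec_index x j * F j)"
proof (intro exI allI impI)
  fix x :: "complex Matrix.vec" assume x: "dim_vec x = Suc N"
  let ?A = "\<lambda>x. mat_of_rows (Suc N) (x # R)"
  have A: "?A x \<in> carrier_mat (Suc N) (Suc N)" using assms by auto
  have "mat_delete (?A x) 0 j = mat_delete (?A (0\<^sub>v (Suc N))) 0 j" if "j < Suc N" for j
    using assms by (intro eq_matI) (auto simp: mat_delete_def mat_of_rows_def)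
  then have c: "cofactor (?A x) 0 j = cofactor (?A (0\<^sub>v (Suc N))) 0 j" if "j < Suc N" for j
    using that by (simp add: cofactor_def)
  have "Determinant.det (?A x) = (\<Sum>j<Suc N. ?A x $$ (0, j) * cofactor (?A x) 0 j)"
    by (rule laplace_expansion_row[OF A]) simp
  also have "\<dots> = (\<Sum>j<Suc N. vec_index x j * cofactor (?A (0\<^sub>v (Suc N))) 0 j)"
    by (intro sum.cong refl) (simp add: mat_of_rows_index c)
  finally show "Determinant.det (?A x) = (\<Sum>j<Suc N. vec_index x j * cofactor (?A (0\<^sub>v (Suc N))) 0 j)" .
qed

text \<open>If \<open>x\<close> is orthogonal to \<open>c\<close>, then \<open>c\<close> is a kernel
  vector of the whole matrix and the determinant vanishes. A linear functional vanishing there is a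
  multiple of the pairing with \<open>c\<close>, and the one-dimensional kernel makes the multiple
  nonzero, so the relation can be inverted.\<close>

lemma det_border_eq:
  fixes R :: "complex Matrix.vec list" and c :: "complex Matrix.vec"
  assumes len: "length R = N" and R: "set R \<subseteq> carrier_vec (Suc N)"
    and c: "c \<in> carrier_vec (Suc N)" "c \<noteq> 0\<^sub>v (Suc N)"
    and ker: "\<And>r. r \<in> set R \<Longrightarrow> scalar_prod r c = 0"
    and one_dim: "\<And>d. d \<in> carrier_vec (Suc N) \<Longrightarrow> (\<And>r. r \<in> set R \<Longrightarrow> scalar_prod r d = 0)
      \<Longrightarrow> \<exists>k. d = k \<cdot>\<^sub>v c"
  shows "\<exists>C. \<forall>x \<in> carrier_vec (Suc N).
    scalar_prod x c = C * Determinant.det (mat_of_rows (Suc N) (x # R))"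
proof -
  let ?D = "\<lambda>x. Determinant.det (mat_of_rows (Suc N) (x # R))"
  have A: "mat_of_rows (Suc N) (x # R) \<in> carrier_mat (Suc N) (Suc N)" for x using len by auto
  have mv: "mat_of_rows (Suc N) (x # R) *\<^sub>v d = 0\<^sub>v (Suc N) \<longleftrightarrow> (\<forall>r \<in> set (x # R). scalar_prod r d = 0)"
    if "x \<in> carrier_vec (Suc N)" for x d
  proof -
    have "mat_of_rows (Suc N) (x # R) *\<^sub>v d = 0\<^sub>v (Suc N)
        \<longleftrightarrow> (\<forall>i < length (x # R). scalar_prod ((x # R) ! i) d = 0)"
      using that R len nth_mem
      by (subst Matrix.vec_eq_iff) (auto simp: subset_iff less_Suc_eq_0_disj mult_mat_vec_def)
    then show ?thesis by (metis in_set_conv_nth)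
  qed
  obtain i where i: "i < Suc N" "vec_index c i \<noteq> 0"
    using c by (metis carrier_vecD eq_vecI index_zero_vec(1) index_zero_vec(2))
  \<comment> \<open>A reference row that is not orthogonal to \<open>c\<close>; it fixes the
    constant of proportionality.\<close>
  define x0 :: "complex Matrix.vec" where "x0 = unit_vec (Suc N) i"
  have x0: "x0 \<in> carrier_vec (Suc N)" "scalar_prod x0 c \<noteq> 0"
    using i c by (auto simp: x0_def)
  \<comment> \<open>A kernel vector would be a multiple of \<open>c\<close> and also orthogonal to
    \<open>x0\<close>, hence zero.\<close>
  have D0: "?D x0 \<noteq> 0"
  proof
    assume "?D x0 = 0"
    then obtain d where d: "d \<in> carrier_vec (Suc N)" "d \<noteq> 0\<^sub>v (Suc N)"
      "mat_of_rows (Suc N) (x0 # R) *\<^sub>v d = 0\<^sub>v (Suc N)"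
      using det_0_iff_vec_prod_zero[OF A] by auto
    with mv[OF x0(1)] have "scalar_prod x0 d = 0" "\<And>r. r \<in> set R \<Longrightarrow> scalar_prod r d = 0" by auto
    with one_dim[OF d(1)] obtain k where k: "d = k \<cdot>\<^sub>v c" by auto
    with \<open>scalar_prod x0 d = 0\<close> x0 c have "k = 0" by auto
    with k c d(2) show False by (auto simp: smult_vec_def)
  qed
  obtain F where F: "\<And>x. dim_vec x = Suc N \<Longrightarrow> ?D x = (\<Sum>j<Suc N. vec_index x j * F j)"
    using det_border_linear[OF len] by blast
  have "scalar_prod x c = scalar_prod x0 c / ?D x0 * ?D x" if x: "x \<in> carrier_vec (Suc N)" for x
  proof -
    \<comment> \<open>This combination is orthogonal to \<open>c\<close>, so its determinant
      vanishes; linearity in the first row then compares \<open>x\<close> with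
      \<open>x0\<close>.\<close>
    define y where "y = scalar_prod x c \<cdot>\<^sub>v x0 - scalar_prod x0 c \<cdot>\<^sub>v x"
    have y: "y \<in> carrier_vec (Suc N)" using x x0 by (auto simp: y_def)
    have "scalar_prod y c = 0"
      unfolding y_def using x x0 c by (subst minus_scalar_prod_distrib[of _ "Suc N"]) auto
    with ker mv[OF y] have "mat_of_rows (Suc N) (y # R) *\<^sub>v c = 0\<^sub>v (Suc N)" by auto
    then have "?D y = 0" using det_0_iff_vec_prod_zero[OF A] c by blast
    moreover have "?D y = scalar_prod x c * ?D x0 - scalar_prod x0 c * ?D x"
      using x x0 y by (simp add: F y_def sum_subtractf sum_distrib_left algebra_simps del: sum.lessThan_Suc)
    ultimately show ?thesis using D0 by (simp add: field_simps)
  qed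
  then show ?thesis by blast
qed

subsection \<open>Polynomials\<close>

lemma prod_linear_dvd:
  assumes "finite J" "inj_on \<alpha> J" "\<And>j. j \<in> J \<Longrightarrow> poly p (\<alpha> j) = 0"
  shows "(\<Prod>j\<in>J. [:- \<alpha> j, 1:]) dvd (p :: complex poly)"
  using assms
proof (induction J rule: finite_induct)
  case empty
  then show ?case by simp
next
  case (insert x J)
  then obtain q where q: "p = (\<Prod>j\<in>J. [:- \<alpha> j, 1:]) * q" by (auto elim: dvdE)
  have "poly (\<Prod>j\<in>J. [:- \<alpha> j, 1:]) (\<alpha> x) \<noteq> 0"
    using insert.hyps insert.prems(1) by (auto simp: poly_prod)
  with q insert.prems(2)[of x] have "poly q (\<alpha> x) = 0" by auto
  then have "[:- \<alpha> x, 1:] dvd q" by (simp add: poly_eq_0_iff_dvd)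
  then show ?case unfolding q prod.insert[OF insert.hyps] by (subst mult.commute[of _ q]) (rule mult_dvd_mono[OF _ dvd_refl])
qed

lemma degree_prod_linear: "degree (\<Prod>j\<in>J. [:- \<alpha> j, 1 :: complex:]) = card J"
  by (subst degree_prod_sum_eq) auto

text \<open>A polynomial of degree below the number of nodes is determined by its values there. Only
  the span of the node products matters later, so the coefficients stay anonymous.\<close>

lemma lagrange_interpolation:
  fixes r :: "complex poly"
  assumes J: "finite J" "inj_on \<beta> J" and r: "degree r < card J"
  shows "\<exists>g. r = (\<Sum>j\<in>J. Polynomial.smult (g j) (\<Prod>i\<in>J - {j}. [:- \<beta> i, 1:]))"
proof -
  let ?Q = "\<lambda>j. \<Prod>i\<in>J - {j}. [:- \<beta> i, 1:]"
  let ?g = "\<lambda>j. poly r (\<beta> j) / poly (?Q j) (\<beta> j)"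
  let ?h = "\<Sum>j\<in>J. Polynomial.smult (?g j) (?Q j)"
  \<comment> \<open>Truncated subtraction is harmless: the degree bound on \<open>r\<close> forces
    \<open>J\<close> to be nonempty.\<close>
  have "degree ?h \<le> card J - 1"
    using J by (intro degree_sum_le) (auto intro: order.trans[OF degree_smult_le] simp: degree_prod_linear)
  with r have h: "degree ?h < card J" by linarith
  have "poly r x = poly ?h x" if "x \<in> \<beta> ` J" for x
  proof -
    from that obtain k where k: "k \<in> J" "x = \<beta> k" by auto
    have "poly (?Q k) x \<noteq> 0" using J k by (auto simp: poly_prod inj_on_def)
    moreover have "poly (?Q j) x = 0" if "j \<in> J" "j \<noteq> k" for j
      using J k that by (auto simp: poly_prod)
    ultimately show ?thesis
      using J k by (simp add: poly_sum sum.remove[of J k])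
  qed
  then have "r = ?h"
    using r h J by (intro poly_eqI_degree[of "\<beta> ` J"]) (auto simp: card_image)
  then show ?thesis by (rule exI[of _ ?g])
qed

subsection \<open>Orthogonal families\<close>

text \<open>\<open>unique\<close> plays the part of a nonvanishing moment determinant.
  \<open>coeff_0\<close> allows elimination from the constant term upwards, which the entries
  carrying a power of the variable require.\<close>

locale orthogonal_family =
  fixes w :: "complex \<Rightarrow> complex" and s :: nat and a :: "nat \<Rightarrow> complex poly"
  assumes weight: "weight w"
    and degree: "degree (a m) = m"
    and coeff_0: "coeff (a m) 0 \<noteq> 0"
    and orthogonal: "degree r < m \<Longrightarrow> moment w (m + s) (a m * r) = 0"
    and unique: "degree q \<le> m \<Longrightarrow> (\<And>r. degree r < m \<Longrightarrow> moment w (m + s) (q * r) = 0)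
      \<Longrightarrow> \<exists>c. q = Polynomial.smult c (a m)"
begin

text \<open>These are the entries of \<open>vrow\<close> as polynomials, so that evaluation and
  Cauchy transform can be applied to one and the same combination.\<close>

definition basis :: "nat \<Rightarrow> nat \<Rightarrow> nat \<Rightarrow> complex poly" where
  "basis L n i = monom 1 (L - i) * a (n - L + i)"

lemma nonzero: "a m \<noteq> 0"
  using coeff_0[of m] by auto

text \<open>At exponent \<open>m + s\<close> the test polynomial gains the power
  \<open>m - n\<close> and still has degree below \<open>m\<close>.\<close>

lemma orthogonal_ge:
  assumes "degree r < n" "n \<le> m"
  shows "moment w (n + s) (a m * r) = 0"
proof -
  have "moment w (n + s) (a m * r) = moment w ((n + s) + (m - n)) (monom 1 (m - n) * (a m * r))"
    by (rule moment_monom_mult[symmetric])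
  also have "\<dots> = moment w (m + s) (a m * (monom 1 (m - n) * r))"
    using assms by (simp add: ac_simps)
  also have "\<dots> = 0"
    using assms degree_mult_le[of "monom 1 (m - n)" r] degree_monom_le[of "1 :: complex" "m - n"]
    by (intro orthogonal) linarith
  finally show ?thesis .
qed

text \<open>This kills the remainder in \<open>cauchy_mult\<close>. Synthetic division lowers a
  positive degree by one, which turns the weak bound into the strict one of
  \<open>orthogonal\<close>; for constant \<open>P\<close> the quotient is zero.\<close>

lemma moment_synthetic_div:
  assumes "degree P \<le> m"
  shows "moment w (m + s) (a m * synthetic_div P z) = 0"
proof (cases "degree P = 0")
  case True
  then have "synthetic_div P z = 0" by (simp add: synthetic_div_eq_0_iff)
  then show ?thesis by simp
next
  case False
  then show ?thesis using assms by (intro orthogonal) (simp add: degree_synthetic_div)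
qed

lemma orthogonal_basis:
  assumes "L \<le> n" "degree r < n - L"
  shows "moment w (n + s) (basis L n i * r) = 0"
proof (cases "i \<le> L")
  case True
  have "moment w ((n - L + i + s) + (L - i)) (monom 1 (L - i) * (a (n - L + i) * r)) = 0"
    unfolding moment_monom_mult using assms by (intro orthogonal) auto
  moreover have "(n - L + i + s) + (L - i) = n + s" using True assms by simp
  ultimately show ?thesis by (simp add: basis_def mult.assoc)
next
  case False
  then show ?thesis using assms by (simp add: basis_def orthogonal_ge)
qed

text \<open>Brings associated functions of different index to the common exponent
  \<open>n + s\<close>, where they are linear in the polynomial. For \<open>i \<le> L\<close> the
  power is absorbed by the exponent; for \<open>i > L\<close> it is pulled out by
  \<open>cauchy_mult\<close>, the remainder vanishing by orthogonality.\<close>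

lemma cauchy_basis:
  assumes "L \<le> n" "norm z \<noteq> 1"
  shows "z ^ (n + s) * cauchy w (n + s) (basis L n i) z
    = z ^ (L - i) * (z ^ (n - L + i + s) * cauchy w (n - L + i + s) (a (n - L + i)) z)"
proof (cases "i \<le> L")
  case True
  have "cauchy w ((n - L + i + s) + (L - i)) (basis L n i) z = cauchy w (n - L + i + s) (a (n - L + i)) z"
    unfolding basis_def by (rule cauchy_monom_mult)
  moreover have "(n - L + i + s) + (L - i) = n + s" using True assms by simp
  ultimately show ?thesis by (simp flip: mult.assoc power_add)
next
  case False
  define k where "k = i - L"
  have k: "n - L + i = n + k" "L - i = 0" using False assms by (auto simp: k_def)
  have "cauchy w (n + s) (a (n + k)) z = cauchy w ((n + s) + k) (monom 1 k * a (n + k)) z"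
    by (rule cauchy_monom_mult[symmetric])
  also have "\<dots> = cauchy w (n + k + s) (a (n + k) * monom 1 k) z"
    by (simp add: ac_simps)
  also have "\<dots> = z ^ k * cauchy w (n + k + s) (a (n + k)) z"
    by (simp add: cauchy_mult[OF weight assms(2)] poly_monom moment_synthetic_div degree_monom_eq)
  finally show ?thesis
    by (simp add: basis_def k power_add mult_ac)
qed

lemma degree_basis_le: "L \<le> n \<Longrightarrow> degree (basis L n i) \<le> n + (i - L)"
  using degree_mult_le[of "monom 1 (L - i)" "a (n - L + i)"] degree_monom_le[of "1 :: complex" "L - i"]
    degree[of "n - L + i"]
  unfolding basis_def by linarith

text \<open>The list is triangular in two ways: up to index \<open>L\<close> the lowest power
  decreases, and beyond \<open>L\<close> the degree increases.\<close>

lemma basis_independent: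
  assumes "L \<le> n" and zero: "(\<Sum>i<D. Polynomial.smult (c i) (basis L n i)) = 0" and "i < D"
  shows "c i = 0"
proof (rule ccontr)
  assume "c i \<noteq> 0"
  define J where "J = {i. i < D \<and> c i \<noteq> 0}"
  have J: "finite J" "J \<noteq> {}" using \<open>c i \<noteq> 0\<close> \<open>i < D\<close> by (auto simp: J_def)
  define m where "m = Max J"
  have m: "m < D" "c m \<noteq> 0" using Max_in[OF J] by (auto simp: m_def J_def)
  have above: "c j = 0" if "j < D" "j > m" for j
  proof -
    have "j \<notin> J" using Max_ge[OF J(1), of j] that(2) unfolding m_def by linarith
    with that(1) show ?thesis by (simp add: J_def)
  qed
  \<comment> \<open>The lowest power of entry \<open>m\<close> when \<open>m \<le> L\<close>, its
    degree otherwise; in both cases no earlier entry has a term of this order.\<close>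
  define k where "k = (if m \<le> L then L - m else n - L + m)"
  have nz: "coeff (basis L n m) k \<noteq> 0"
  proof (cases "m \<le> L")
    case True
    then show ?thesis using coeff_0 by (simp add: k_def basis_def coeff_monom_mult)
  next
    case False
    have "coeff (a (n - L + m)) (n - L + m) \<noteq> 0"
      using nonzero degree by (metis leading_coeff_neq_0)
    with False show ?thesis by (simp add: k_def basis_def)
  qed
  have below: "coeff (basis L n j) k = 0" if "j < m" for j
  proof (cases "m \<le> L")
    case True
    with that show ?thesis by (simp add: k_def basis_def coeff_monom_mult)
  next
    case False
    with that assms(1) degree_basis_le[OF assms(1), of j] show ?thesis
      by (intro coeff_eq_0) (simp add: k_def)
  qed
  have "0 = (\<Sum>j<D. c j * coeff (basis L n j) k)"
    using arg_cong[OF zero, of "\<lambda>p. coeff p k"] by (simp add: coeff_sum)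
  also have "\<dots> = (\<Sum>j\<in>{m}. c j * coeff (basis L n j) k)"
    using m above below by (intro sum.mono_neutral_right) (auto simp: nat_neq_iff)
  finally show False using m nz by simp
qed

text \<open>Induction on \<open>L\<close>: subtracting a multiple of \<open>a n\<close> removes the
  constant term, and the quotient by the variable satisfies the hypotheses with \<open>n\<close> and
  \<open>L\<close> both lowered by one, so \<open>n - L\<close> is unchanged. The start is
  \<open>unique\<close>.\<close>

lemma basis_span_degree_le:
  assumes "L \<le> n" "degree p \<le> n" "\<And>r. degree r < n - L \<Longrightarrow> moment w (n + s) (p * r) = 0"
  shows "\<exists>c. p = (\<Sum>i<Suc L. Polynomial.smult (c i) (basis L n i))"
  using assms
proof (induction L arbitrary: n p)
  case 0
  then obtain c where "p = Polynomial.smult c (a n)" using unique[of p n] by auto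
  then show ?case by (intro exI[of _ "\<lambda>_. c"]) (simp add: basis_def)
next
  case (Suc L)
  then obtain n' where n: "n = Suc n'" "L \<le> n'" by (cases n) auto
  define d where "d = coeff p 0 / coeff (a n) 0"
  define q where "q = synthetic_div (p - Polynomial.smult d (a n)) 0"
  have "poly (p - Polynomial.smult d (a n)) 0 = 0"
    using coeff_0[of n] by (simp add: poly_0_coeff_0 d_def)
  with synthetic_div_correct[of "p - Polynomial.smult d (a n)" 0]
  have q: "p = monom 1 1 * q + Polynomial.smult d (a n)"
    by (simp add: q_def monom_altdef algebra_simps)
  have degq: "degree q \<le> n'"
    using degree_diff_le_max[of p "Polynomial.smult d (a n)"] degree_smult_le[of d "a n"] Suc.prems(2) n degree[of n]
    by (simp add: q_def degree_synthetic_div)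
  have "moment w (n' + s) (q * r) = 0" if r: "degree r < n' - L" for r
  proof -
    have "moment w (n' + s) (q * r) = moment w ((n' + s) + 1) (monom 1 1 * (q * r))"
      by (rule moment_monom_mult[symmetric])
    also have "monom 1 1 * (q * r) = p * r - Polynomial.smult d (a n * r)"
      unfolding q by (simp add: algebra_simps)
    also have "moment w ((n' + s) + 1) (p * r - Polynomial.smult d (a n * r)) = 0"
      using Suc.prems(3)[of r] orthogonal[of r n] r n
      by (simp add: moment_diff[OF weight] moment_smult)
    finally show ?thesis .
  qed
  from Suc.IH[OF n(2) degq this] obtain c where c: "q = (\<Sum>i<Suc L. Polynomial.smult (c i) (basis L n' i))"
    by blast
  have "monom 1 1 * basis L n' i = basis (Suc L) n i" if "i < Suc L" for i
    using that n by (simp add: basis_def mult_monom Suc_diff_le flip: mult.assoc)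
  then have "monom 1 1 * q = (\<Sum>i<Suc L. Polynomial.smult (c i) (basis (Suc L) n i))"
    unfolding c sum_distrib_left by (intro sum.cong) auto
  moreover have "a n = basis (Suc L) n (Suc L)" using Suc.prems(1) by (simp add: basis_def)
  ultimately have "p = (\<Sum>i<Suc (Suc L). Polynomial.smult ((c(Suc L := d)) i) (basis (Suc L) n i))"
    unfolding q sum.lessThan_Suc[of _ "Suc L"] by simp
  then show ?case by blast
qed

text \<open>Induction on \<open>K\<close>: subtracting a multiple of \<open>a (n + K)\<close>
  removes the top coefficient and keeps the moment conditions by
  \<open>orthogonal_ge\<close>.\<close>

lemma basis_span:
  assumes "L \<le> n" "degree p \<le> n + K" "\<And>r. degree r < n - L \<Longrightarrow> moment w (n + s) (p * r) = 0"
  shows "\<exists>c. p = (\<Sum>i<Suc (L + K). Polynomial.smult (c i) (basis L n i))"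
  using assms(2,3)
proof (induction K arbitrary: p)
  case 0
  then show ?case using basis_span_degree_le[OF assms(1), of p] by simp
next
  case (Suc K)
  let ?m = "n + Suc K"
  define d where "d = coeff p ?m / coeff (a ?m) ?m"
  define q where "q = p - Polynomial.smult d (a ?m)"
  have lc: "coeff (a ?m) ?m \<noteq> 0"
    using nonzero degree by (metis leading_coeff_neq_0)
  have "degree q \<le> ?m"
    using degree_diff_le_max[of p "Polynomial.smult d (a ?m)"] degree_smult_le[of d "a ?m"] Suc.prems(1) degree[of ?m]
    by (simp add: q_def)
  moreover have "coeff q ?m = 0" using lc by (simp add: q_def d_def)
  ultimately have degq: "degree q \<le> n + K"
    by (intro degree_le) (metis add_Suc_right coeff_eq_0 le_antisym not_less not_less_eq_eq order.strict_trans1)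
  have "moment w (n + s) (q * r) = 0" if r: "degree r < n - L" for r
    using Suc.prems(2)[OF r] orthogonal_ge[of r n ?m] r
    by (simp add: q_def left_diff_distrib moment_diff[OF weight] moment_smult)
  from Suc.IH[OF degq this] obtain c where c: "q = (\<Sum>i<Suc (L + K). Polynomial.smult (c i) (basis L n i))"
    by blast
  have "a ?m = basis L n (Suc (L + K))" using assms(1) by (simp add: basis_def)
  then have "p = q + Polynomial.smult d (basis L n (Suc (L + K)))" by (simp add: q_def)
  also have "\<dots> = (\<Sum>i<Suc (L + Suc K). Polynomial.smult ((c(Suc (L + K) := d)) i) (basis L n i))"
    unfolding c by simp
  finally show ?case by blast
qed

end

context orthogonal_family
begin

text \<open>This makes the bordering rows of the determinant independent: the multiples of \<open>P\<close> together
  with the quotients of \<open>P\<close> by its linear factors span all polynomials of degree below \<open>n\<close>.\<close>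

lemma orthogonal_if_cauchy_zero:
  assumes J: "finite J" "inj_on \<beta> J" "\<And>j. j \<in> J \<Longrightarrow> norm (\<beta> j) \<noteq> 1" "card J \<le> n"
    and P: "P = (\<Prod>j\<in>J. [:- \<beta> j, 1:])"
    and low: "\<And>r. degree r < n - card J \<Longrightarrow> moment w N (P * q * r) = 0"
    and zero: "\<And>j. j \<in> J \<Longrightarrow> cauchy w N (P * q) (\<beta> j) = 0"
    and r: "degree r < n"
  shows "moment w N (q * r) = 0"
proof -
  have degP: "degree P = card J" and P0: "P \<noteq> 0"
    using J(1) by (simp_all add: P degree_prod_linear)
  have rem: "moment w N (q * r2) = 0" if "degree r2 < card J" for r2
  proof -
    obtain g where g: "r2 = (\<Sum>j\<in>J. Polynomial.smult (g j) (\<Prod>i\<in>J - {j}. [:- \<beta> i, 1:]))"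
      using lagrange_interpolation[OF J(1,2) \<open>degree r2 < card J\<close>] by blast
    \<comment> \<open>Dividing \<open>P * q\<close> by one linear factor leaves \<open>q\<close>
      times a node product, so this moment is the Cauchy transform of \<open>P * q\<close> at that
      node.\<close>
    have "moment w N (q * (\<Prod>i\<in>J - {j}. [:- \<beta> i, 1:])) = 0" if "j \<in> J" for j
    proof -
      have "P * q = [:- \<beta> j, 1:] * (q * (\<Prod>i\<in>J - {j}. [:- \<beta> i, 1:]))"
        unfolding P prod.remove[OF J(1) that] by (simp only: ac_simps)
      then show ?thesis
        using zero[OF that] cauchy_linear_factor[OF J(3)[OF that]] by metis
    qed
    then show ?thesis
      unfolding g sum_distrib_left mult_smult_right by (simp add: moment_sum[OF weight])
  qed
  \<comment> \<open>A multiple of \<open>P\<close> of degree below \<open>n\<close> has cofactor of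
    degree below \<open>n - card J\<close>, which is the range of \<open>low\<close>.\<close>
  have quo: "moment w N (q * (P * (r div P))) = 0"
  proof (cases "r div P = 0")
    case False
    have "degree (P * (r div P)) \<le> degree r"
      using degree_diff_le_max[of r "r mod P"] degree_mod_less[OF P0, of r]
        div_poly_less[of r P] False
      by (auto simp: minus_mod_eq_mult_div max_def split: if_splits)
    then have "degree (r div P) < n - card J"
      using r degP degree_mult_eq[OF P0 False] by linarith
    from low[OF this] show ?thesis by (simp only: ac_simps)
  qed simp
  have "r mod P = 0 \<or> degree (r mod P) < card J"
    using degree_mod_less[OF P0, of r] degP by simp
  then have "moment w N (q * (r mod P)) = 0" using rem by auto
  moreover have "q * r = q * (P * (r div P)) + q * (r mod P)"
    by (simp flip: distrib_left)
  ultimately show ?thesis using quo by (simp only: moment_add[OF weight] add_0)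
qed

end

subsection \<open>Determinant formula for orthogonal families\<close>

lemma vrow_poly_fun:
  assumes "orthogonal_family w s a" "c \<in> carrier_vec (Suc (L + K))"
  shows "scalar_prod (vrow K L n (poly_fun a) z) c
    = poly (\<Sum>i<Suc (L + K). Polynomial.smult (vec_index c i) (orthogonal_family.basis a L n i)) z"
  using assms(2) orthogonal_family.basis_def[OF assms(1)]
  by (auto simp: scalar_prod_def vrow_def poly_fun_def poly_sum poly_monom atLeast0LessThan
      mult.commute simp del: sum.lessThan_Suc intro!: sum.cong)

text \<open>Together with \<open>vrow_poly_fun\<close> this reads a vector \<open>c\<close> as a
  single polynomial: rows of \<open>a\<close> evaluate it, rows of \<open>b\<close> take its Cauchy
  transform.\<close>

lemma vrow_cauchy:
  assumes "orthogonal_family w s a" "c \<in> carrier_vec (Suc (L + K))" "L \<le> n" "norm z \<noteq> 1"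
    and b: "\<And>m. b m z = e * z ^ (m + s) * cauchy w (m + s) (a m) z"
  shows "scalar_prod (vrow K L n b z) c
    = e * z ^ (n + s) * cauchy w (n + s)
        (\<Sum>i<Suc (L + K). Polynomial.smult (vec_index c i) (orthogonal_family.basis a L n i)) z"
proof -
  interpret orthogonal_family w s a by fact
  have "z ^ (L - i) * b (n - L + i) z = e * (z ^ (n + s) * cauchy w (n + s) (basis L n i) z)" for i
    unfolding cauchy_basis[OF assms(3,4)] b by (simp add: mult_ac)
  then show ?thesis
    using assms(2)
    by (simp add: scalar_prod_def vrow_def cauchy_sum[OF weight assms(4)] sum_distrib_left
        atLeast0LessThan mult_ac del: sum.lessThan_Suc)
qed

text \<open>Covers both families at once through \<open>s\<close> and \<open>e\<close>. The two
  formulas share \<open>C\<close> because their determinants differ only in the first row.\<close>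

lemma row_det_formula:
  fixes K L n :: nat and \<alpha> \<beta> :: "nat \<Rightarrow> complex"
  defines "P \<equiv> \<Prod>j=1..K. [:- \<alpha> j, 1:]" and "Q \<equiv> \<Prod>j=1..L. [:- \<beta> j, 1:]"
  assumes fam: "orthogonal_family w s a" and fam': "orthogonal_family w' s A"
    and transfer: "\<And>\<zeta>. norm \<zeta> = 1 \<Longrightarrow> w \<zeta> * poly P \<zeta> = w' \<zeta> * poly Q \<zeta>"
    and inj: "inj_on \<alpha> {1..K}" "inj_on \<beta> {1..L}"
    and \<beta>: "\<And>j. j \<in> {1..L} \<Longrightarrow> \<beta> j \<noteq> 0 \<and> norm (\<beta> j) \<noteq> 1"
    and "L \<le> n" and "e \<noteq> 0"
    and b: "\<And>m z. norm z \<noteq> 1 \<Longrightarrow> b m z = e * z ^ (m + s) * cauchy w (m + s) (a m) z"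
    and B: "\<And>m z. norm z \<noteq> 1 \<Longrightarrow> B m z = e * z ^ (m + s) * cauchy w' (m + s) (A m) z"
  shows "\<exists>C. (\<forall>z. (\<Prod>j=1..K. z - \<alpha> j) * poly (A n) z
                = C * row_det K L n \<alpha> \<beta> (poly_fun a) b (poly_fun a) z)
           \<and> (\<forall>z. norm z \<noteq> 1 \<longrightarrow> (\<Prod>j=1..L. z - \<beta> j) * B n z
                = C * row_det K L n \<alpha> \<beta> (poly_fun a) b b z)"
proof -
  interpret orthogonal_family w s a by fact
  interpret hat: orthogonal_family w' s A by fact
  define D where "D = Suc (L + K)"
  define comb where "comb c = (\<Sum>i<D. Polynomial.smult (vec_index c i) (basis L n i))"
    for c :: "complex Matrix.vec"
  have dot_a: "scalar_prod (vrow K L n (poly_fun a) z) d = poly (comb d) z"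
    if "d \<in> carrier_vec D" for d z
    using vrow_poly_fun[OF fam] that unfolding D_def comb_def by blast
  have dot_b: "scalar_prod (vrow K L n b z) d = e * z ^ (n + s) * cauchy w (n + s) (comb d) z"
    if "d \<in> carrier_vec D" "norm z \<noteq> 1" for d z
    using vrow_cauchy[OF fam _ \<open>L \<le> n\<close> that(2), of d K b e] b that unfolding D_def comb_def by blast
  have poly_P: "poly P z = (\<Prod>j=1..K. z - \<alpha> j)" and poly_Q: "poly Q z = (\<Prod>j=1..L. z - \<beta> j)" for z
    by (simp_all add: P_def Q_def poly_prod)
  have degP: "degree P = K" and degQ: "degree Q = L" and P0: "P \<noteq> 0"
    by (simp_all add: P_def Q_def degree_prod_linear)
  define f where "f = P * A n"
  have "f \<noteq> 0" using P0 hat.nonzero by (simp add: f_def)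
  have "degree f \<le> n + K"
    using degree_mult_le[of P "A n"] degP hat.degree[of n] by (simp add: f_def)
  \<comment> \<open>Changing weights trades \<open>P\<close> for \<open>Q\<close>, and
    \<open>Q\<close> uses up \<open>L\<close> of the \<open>n\<close> orthogonality conditions of
    \<open>A n\<close>.\<close>
  moreover have "moment w (n + s) (f * r) = 0" if r: "degree r < n - L" for r
  proof -
    have "moment w (n + s) (f * r) = moment w' (n + s) (Q * (A n * r))"
      unfolding f_def mult.assoc by (rule moment_transfer[OF transfer])
    also have "Q * (A n * r) = A n * (Q * r)" by (simp only: ac_simps)
    also have "moment w' (n + s) (A n * (Q * r)) = 0"
      using degree_mult_le[of Q r] degQ r by (intro hat.orthogonal) linarith
    finally show ?thesis .
  qed
  ultimately obtain g where g: "f = (\<Sum>i<D. Polynomial.smult (g i) (basis L n i))"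
    using basis_span[OF \<open>L \<le> n\<close>] unfolding D_def by blast
  define c where "c = Matrix.vec D g"
  have c: "c \<in> carrier_vec D" and comb_c: "comb c = f"
    by (simp_all add: c_def comb_def g)
  have "c \<noteq> 0\<^sub>v D" using \<open>f \<noteq> 0\<close> comb_c by (auto simp: comb_def)
  \<comment> \<open>After the trade of \<open>P\<close> for \<open>Q\<close>, the factor
    \<open>Q\<close> comes out as a scalar because its degree \<open>L\<close> is at most
    \<open>n\<close>.\<close>
  have cauchy_f: "cauchy w (n + s) f z = poly Q z * cauchy w' (n + s) (A n) z" if "norm z \<noteq> 1" for z
  proof -
    have "cauchy w (n + s) f z = cauchy w' (n + s) (A n * Q) z"
      unfolding f_def mult.commute[of "A n"] by (rule cauchy_transfer[OF transfer])
    then show ?thesis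
      using cauchy_mult[OF hat.weight that] hat.moment_synthetic_div \<open>L \<le> n\<close> degQ by simp
  qed
  define R where "R = map (\<lambda>j. vrow K L n (poly_fun a) (\<alpha> j)) [1..<K + 1]
        @ map (\<lambda>j. inverse (\<beta> j ^ n) \<cdot>\<^sub>v vrow K L n b (\<beta> j)) [1..<L + 1]"
  have vrow_carrier: "vrow K L n h z \<in> carrier_vec D" for h z
    by (simp add: vrow_def D_def)
  have R_ball: "(\<forall>r\<in>set R. scalar_prod r d = 0) \<longleftrightarrow>
      (\<forall>j\<in>{1..K}. poly (comb d) (\<alpha> j) = 0) \<and> (\<forall>j\<in>{1..L}. cauchy w (n + s) (comb d) (\<beta> j) = 0)"
    if d: "d \<in> carrier_vec D" for d
  proof -
    have "scalar_prod (inverse (\<beta> j ^ n) \<cdot>\<^sub>v vrow K L n b (\<beta> j)) d = 0 \<longleftrightarrow> cauchy w (n + s) (comb d) (\<beta> j) = 0"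
      if "j \<in> {1..L}" for j
      using \<beta>[OF that] \<open>e \<noteq> 0\<close> by (simp add: smult_scalar_prod_distrib[OF vrow_carrier d] dot_b[OF d])
    moreover have "set R = (\<lambda>j. vrow K L n (poly_fun a) (\<alpha> j)) ` {1..K}
        \<union> (\<lambda>j. inverse (\<beta> j ^ n) \<cdot>\<^sub>v vrow K L n b (\<beta> j)) ` {1..L}"
      by (auto simp: R_def atLeastLessThanSuc_atLeastAtMost)
    ultimately show ?thesis by (simp add: ball_Un dot_a[OF d])
  qed
  have "\<exists>C. \<forall>x \<in> carrier_vec (Suc (L + K)).
      scalar_prod x c = C * Determinant.det (mat_of_rows (Suc (L + K)) (x # R))"
  proof (rule det_border_eq)
    show "length R = L + K" by (simp add: R_def)
    show "set R \<subseteq> carrier_vec (Suc (L + K))"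
      using vrow_carrier by (auto simp: R_def D_def)
    show "c \<in> carrier_vec (Suc (L + K))" "c \<noteq> 0\<^sub>v (Suc (L + K))"
      using c \<open>c \<noteq> 0\<^sub>v D\<close> by (simp_all add: D_def)
    have "poly f (\<alpha> j) = 0" if "j \<in> {1..K}" for j
      using that by (auto simp: f_def poly_P)
    moreover have "cauchy w (n + s) f (\<beta> j) = 0" if "j \<in> {1..L}" for j
      using that \<beta>[OF that] by (auto simp: cauchy_f poly_Q)
    ultimately show "scalar_prod r c = 0" if "r \<in> set R" for r
      using R_ball[OF c] that unfolding comb_c by blast
  next
    fix d assume "d \<in> carrier_vec (Suc (L + K))" and ker: "\<And>r. r \<in> set R \<Longrightarrow> scalar_prod r d = 0"
    then have d: "d \<in> carrier_vec D" by (simp add: D_def)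
    from R_ball[OF d] ker have \<alpha>0: "\<And>j. j \<in> {1..K} \<Longrightarrow> poly (comb d) (\<alpha> j) = 0"
      and \<beta>0: "\<And>j. j \<in> {1..L} \<Longrightarrow> cauchy w (n + s) (comb d) (\<beta> j) = 0" by blast+
    obtain q where q: "comb d = P * q"
      using prod_linear_dvd[OF _ inj(1) \<alpha>0] unfolding P_def by (auto elim: dvdE)
    have "degree (basis L n i) \<le> n + K" if "i < D" for i
      using degree_basis_le[OF \<open>L \<le> n\<close>, of i] that by (simp add: D_def)
    then have "degree (comb d) \<le> n + K"
      unfolding comb_def by (intro degree_sum_le) (auto intro: order.trans[OF degree_smult_le])
    then have degq: "degree q \<le> n"
      using degP P0 by (cases "q = 0") (auto simp: q degree_mult_eq)
    \<comment> \<open>The Cauchy conditions at the \<beta> points supply the \<open>L\<close>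
      orthogonality conditions that the span of the basis leaves open, so \<open>unique\<close>
      applies to \<open>q\<close>.\<close>
    have "moment w' (n + s) (q * r) = 0" if r: "degree r < n" for r
    proof (rule hat.orthogonal_if_cauchy_zero[of "{1..L}" \<beta> n, OF _ inj(2) _ _ Q_def[THEN meta_eq_to_obj_eq] _ _ r])
      fix r :: "complex poly" assume r: "degree r < n - card {1..L}"
      have "moment w' (n + s) (Q * q * r) = moment w (n + s) (comb d * r)"
        unfolding q mult.assoc by (rule moment_transfer[OF transfer, symmetric])
      also have "\<dots> = 0"
        unfolding comb_def sum_distrib_right mult_smult_left
        using r \<open>L \<le> n\<close> by (simp add: moment_sum[OF weight] orthogonal_basis del: sum.lessThan_Suc)
      finally show "moment w' (n + s) (Q * q * r) = 0" .
    next
      fix j assume "j \<in> {1..L}"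
      from \<beta>0[OF this] show "cauchy w' (n + s) (Q * q) (\<beta> j) = 0"
        using cauchy_transfer[OF transfer, of "n + s" q "\<beta> j"] by (simp add: q)
    qed (use \<beta> \<open>L \<le> n\<close> in auto)
    from hat.unique[OF degq this] obtain k where "q = Polynomial.smult k (A n)" by blast
    then have "comb d = [:k:] * comb c" by (simp add: q comb_c f_def)
    \<comment> \<open>Independence of the basis turns proportional polynomials into proportional
      coefficient vectors.\<close>
    moreover have "(\<Sum>i<D. Polynomial.smult (vec_index d i - k * vec_index c i) (basis L n i))
        = comb d - [:k:] * comb c"
      unfolding comb_def sum_distrib_left by (simp add: smult_diff_left sum_subtractf mult.commute)
    ultimately have "(\<Sum>i<D. Polynomial.smult (vec_index d i - k * vec_index c i) (basis L n i)) = 0"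
      by simp
    from basis_independent[OF \<open>L \<le> n\<close> this]
    have "d = k \<cdot>\<^sub>v c" using c d by (intro eq_vecI) auto
    then show "\<exists>k. d = k \<cdot>\<^sub>v c" by blast
  qed
  then obtain C where C: "\<And>x. x \<in> carrier_vec D \<Longrightarrow>
      scalar_prod x c = C * Determinant.det (mat_of_rows D (x # R))"
    unfolding D_def by blast
  have row_det: "C * row_det K L n \<alpha> \<beta> (poly_fun a) b h z = scalar_prod (vrow K L n h z) c" for h z
    using C[OF vrow_carrier] by (simp add: row_det_def R_def D_def)
  show ?thesis
  proof (intro exI[of _ C] conjI allI impI)
    fix z
    show "(\<Prod>j=1..K. z - \<alpha> j) * poly (A n) z = C * row_det K L n \<alpha> \<beta> (poly_fun a) b (poly_fun a) z"
      unfolding row_det dot_a[OF c] comb_c by (simp add: f_def poly_P)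
  next
    fix z :: complex assume z: "norm z \<noteq> 1"
    show "(\<Prod>j=1..L. z - \<beta> j) * B n z = C * row_det K L n \<alpha> \<beta> (poly_fun a) b b z"
      unfolding row_det dot_b[OF c z] comb_c cauchy_f[OF z] B[OF z] poly_Q
      by (simp add: mult_ac)
  qed
qed

subsection \<open>Bi-orthogonal systems\<close>

text \<open>One polynomial in each degree gives a triangular basis, so leading terms can be removed
  successively. It is applied to either argument of the pairing.\<close>

lemma linear_functional_zero:
  fixes B :: "complex poly \<Rightarrow> complex" and \<psi> :: "nat \<Rightarrow> complex poly"
  assumes add: "\<And>p q. B (p + q) = B p + B q" and smult: "\<And>c p. B (Polynomial.smult c p) = c * B p"
    and \<psi>: "\<And>k. degree (\<psi> k) = k" "\<And>k. \<psi> k \<noteq> 0"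
    and zero: "\<And>k. k < m \<Longrightarrow> B (\<psi> k) = 0" and r: "degree r < m"
  shows "B r = 0"
  using r
proof (induction "degree r" arbitrary: r rule: less_induct)
  case less
  let ?d = "degree r"
  define c where "c = coeff r ?d / coeff (\<psi> ?d) ?d"
  define q where "q = r - Polynomial.smult c (\<psi> ?d)"
  have lc: "coeff (\<psi> ?d) ?d \<noteq> 0" using \<psi> by (metis leading_coeff_neq_0)
  have "coeff q ?d = 0" using lc by (simp add: q_def c_def)
  moreover have "degree q \<le> ?d"
    using degree_diff_le_max[of r "Polynomial.smult c (\<psi> ?d)"] degree_smult_le[of c "\<psi> ?d"] \<psi>(1)[of ?d]
    by (simp add: q_def)
  ultimately have "q = 0 \<or> degree q < ?d" by (metis leading_coeff_0_iff le_neq_implies_less)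
  moreover have "B 0 = 0" using smult[of 0 0] by simp
  ultimately have "B q = 0" using less by (metis order.strict_trans)
  moreover have "r = q + Polynomial.smult c (\<psi> ?d)" by (simp add: q_def)
  ultimately show ?case using add smult zero[OF less.prems] by (metis add_0 mult_zero_right)
qed

locale biorthogonal =
  fixes w :: "complex \<Rightarrow> complex" and \<kappa> :: "nat \<Rightarrow> complex" and \<phi> \<phi>b :: "nat \<Rightarrow> complex poly"
  assumes weight: "weight w"
    and system: "biorthogonal_system w \<kappa> \<phi> \<phi>b"
    and generic: "generic_system \<kappa> \<phi> \<phi>b"
begin

definition pairing :: "complex poly \<Rightarrow> complex poly \<Rightarrow> complex" where
  "pairing p q = wint w (\<lambda>\<zeta>. poly p \<zeta> * poly q (1 / \<zeta>))"

lemma pairing_add_left: "pairing (p + p') q = pairing p q + pairing p' q"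
  unfolding pairing_def poly_add distrib_right
  by (intro wint_add weight continuous_intros) auto

lemma pairing_add_right: "pairing p (q + q') = pairing p q + pairing p q'"
  unfolding pairing_def poly_add distrib_left
  by (intro wint_add weight continuous_intros) auto

lemma pairing_smult_left: "pairing (Polynomial.smult c p) q = c * pairing p q"
  unfolding pairing_def wint_cmult[symmetric] by (simp add: mult_ac)

lemma pairing_smult_right: "pairing p (Polynomial.smult c q) = c * pairing p q"
  unfolding pairing_def wint_cmult[symmetric] by (simp add: mult_ac)

lemma degree: "degree (\<phi> m) = m" "degree (\<phi>b m) = m"
  and lead_coeff: "coeff (\<phi> m) m = \<kappa> m" "coeff (\<phi>b m) m = \<kappa> m"
  and pairing: "pairing (\<phi> m) (\<phi>b k) = (if m = k then 1 else 0)"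
proof -
  have "circ_int (\<lambda>\<zeta>. w \<zeta> * poly (\<phi> m) \<zeta> * poly (\<phi>b k) (1 / \<zeta>)) = (if m = k then 1 else 0)"
    using system unfolding biorthogonal_system_def by blast
  then show "pairing (\<phi> m) (\<phi>b k) = (if m = k then 1 else 0)"
    unfolding pairing_def wint_def mult.assoc .
qed (use system[unfolded biorthogonal_system_def] in metis)+

lemma nonzero: "\<phi> m \<noteq> 0" "\<phi>b m \<noteq> 0"
  using pairing[of m m] pairing_smult_left[of 0 0 "\<phi>b m"] pairing_smult_right[of "\<phi> m" 0 0] by auto

lemma \<kappa>_nonzero: "\<kappa> m \<noteq> 0"
  using lead_coeff(1)[of m] degree(1)[of m] nonzero(1)[of m] by (metis leading_coeff_0_iff)

text \<open>Genericity enters here: a nonzero product of the reflection coefficients excludes zero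
  constant terms for positive \<open>m\<close>. For \<open>m = 0\<close> the constant term is the
  leading coefficient.\<close>

lemma coeff_0: "coeff (\<phi> m) 0 \<noteq> 0" "coeff (\<phi>b m) 0 \<noteq> 0"
  using generic[unfolded generic_system_def Let_def, rule_format, of m] lead_coeff[of 0] \<kappa>_nonzero[of 0]
  by (cases "m = 0"; force simp: poly_0_coeff_0)+

lemma pairing_zero:
  assumes "degree r < m"
  shows "pairing (\<phi> m) r = 0" "pairing r (\<phi>b m) = 0"
  using linear_functional_zero[of "pairing (\<phi> m)" \<phi>b m r] assms
    linear_functional_zero[of "\<lambda>p. pairing p (\<phi>b m)" \<phi> m r] degree nonzero pairing
    pairing_add_left pairing_add_right pairing_smult_left pairing_smult_right
  by simp_all

text \<open>On the circle, \<open>\<zeta> ^ (1 - n) * r \<zeta>\<close> with \<open>degree r < n\<close> is a polynomial in \<open>1 / \<zeta>\<close>.\<close>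

lemma moment_eq_pairing:
  assumes "degree r < n"
  shows "moment w n (p * r) = pairing p (monom 1 (n - 1 - degree r) * reflect_poly r)"
  unfolding moment_def pairing_def
proof (rule wint_cong)
  fix \<zeta> :: complex assume "norm \<zeta> = 1"
  then have \<zeta>: "\<zeta> \<noteq> 0" by auto
  have "poly (reflect_poly r) (1 / \<zeta>) = poly r \<zeta> / \<zeta> ^ degree r"
    using poly_reflect_poly_nz[of "1 / \<zeta>" r] \<zeta> by (simp add: power_one_over)
  moreover have "\<zeta> ^ n = \<zeta> * \<zeta> ^ (n - 1 - degree r) * \<zeta> ^ degree r"
    using assms by (simp flip: power_Suc power_add add: mult.assoc)
  ultimately have "poly (p * r) \<zeta> * \<zeta> / \<zeta> ^ n
      = poly p \<zeta> * poly (monom 1 (n - 1 - degree r) * reflect_poly r) (1 / \<zeta>)"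
    using \<zeta> by (simp add: poly_monom power_one_over)
  then show "w \<zeta> * (poly (p * r) \<zeta> * \<zeta> / \<zeta> ^ n)
      = w \<zeta> * (poly p \<zeta> * poly (monom 1 (n - 1 - degree r) * reflect_poly r) (1 / \<zeta>))"
    by simp
qed

text \<open>On the circle the reversed polynomial is \<zeta>^n times \<open>\<phi>b n\<close> at 1 /
  \<zeta>; cancelling that power leaves the exponent offset \<open>s = 1\<close> of the reciprocal
  family.\<close>

lemma moment_reflect_eq_pairing: "moment w (Suc n) (reflect_poly (\<phi>b n) * r) = pairing r (\<phi>b n)"
  unfolding moment_def pairing_def
proof (rule wint_cong)
  fix \<zeta> :: complex assume "norm \<zeta> = 1"
  then have "\<zeta> \<noteq> 0" by auto
  then show "w \<zeta> * (poly (reflect_poly (\<phi>b n) * r) \<zeta> * \<zeta> / \<zeta> ^ Suc n)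
      = w \<zeta> * (poly r \<zeta> * poly (\<phi>b n) (1 / \<zeta>))"
    using degree[of n] by (simp add: poly_reflect_poly_nz inverse_eq_divide)
qed

lemma moment_\<phi>: "degree r < m \<Longrightarrow> moment w m (\<phi> m * r) = 0"
proof -
  assume r: "degree r < m"
  have "degree (monom 1 (m - 1 - degree r) * reflect_poly r) \<le> (m - 1 - degree r) + degree r"
    by (intro order.trans[OF degree_mult_le] add_mono degree_monom_le degree_reflect_poly_le)
  with r have "degree (monom 1 (m - 1 - degree r) * reflect_poly r) < m" by linarith
  then show ?thesis unfolding moment_eq_pairing[OF r] by (rule pairing_zero)
qed

text \<open>Nondegeneracy of the moment form. Pairing \<open>q\<close> with \<open>\<phi>b\<close>
  of its own degree reads off its leading coefficient up to a nonzero factor, and this pairing is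
  one of the vanishing moments.\<close>

lemma zero_if_orthogonal:
  assumes "degree q < n" and orth: "\<And>r. degree r < n \<Longrightarrow> moment w n (q * r) = 0"
  shows "q = 0"
proof -
  let ?d = "degree q"
  define c where "c = coeff q ?d / \<kappa> ?d"
  define p where "p = q - Polynomial.smult c (\<phi> ?d)"
  have "coeff p ?d = 0" using \<kappa>_nonzero by (simp add: p_def c_def lead_coeff)
  moreover have "degree p \<le> ?d"
    using degree_diff_le_max[of q "Polynomial.smult c (\<phi> ?d)"] degree_smult_le[of c "\<phi> ?d"] degree(1)[of ?d]
    by (simp add: p_def)
  ultimately have "p = 0 \<or> degree p < ?d" by (metis leading_coeff_0_iff le_neq_implies_less)
  then have "pairing p (\<phi>b ?d) = 0"
    using pairing_zero(2)[of p ?d] pairing_smult_left[of 0 0 "\<phi>b ?d"] by auto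
  moreover have "q = p + Polynomial.smult c (\<phi> ?d)" by (simp add: p_def)
  ultimately have "pairing q (\<phi>b ?d) = c"
    using pairing_add_left pairing_smult_left pairing[of ?d ?d] by (metis add_0 mult.right_neutral)
  \<comment> \<open>The test polynomial is the reversed \<open>\<phi>b ?d\<close> times the power
    that raises the exponent from \<open>Suc ?d\<close> to \<open>n\<close>; its degree stays below
    \<open>n\<close>.\<close>
  moreover have "pairing q (\<phi>b ?d) = 0"
  proof -
    let ?r = "reflect_poly (\<phi>b ?d)"
    have deg_r: "degree ?r = ?d" and "reflect_poly ?r = \<phi>b ?d"
      using coeff_0(2) degree(2) by simp_all
    have "degree (monom 1 (n - 1 - ?d) * ?r) \<le> (n - 1 - ?d) + ?d"
      using degree_mult_le[of "monom 1 (n - 1 - ?d)" ?r] degree_monom_le[of "1 :: complex" "n - 1 - ?d"] deg_r by linarith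
    with assms(1) have "degree (monom 1 (n - 1 - ?d) * ?r) < n" by linarith
    from orth[OF this] have "moment w n (q * (monom 1 (n - 1 - ?d) * ?r)) = 0" .
    also have "moment w n (q * (monom 1 (n - 1 - ?d) * ?r))
        = moment w (Suc ?d + (n - 1 - ?d)) (monom 1 (n - 1 - ?d) * (?r * q))"
      using assms(1) by (simp add: mult_ac)
    also have "\<dots> = pairing q (\<phi>b ?d)"
      unfolding moment_monom_mult moment_reflect_eq_pairing ..
    finally show ?thesis .
  qed
  ultimately have "c = 0" by simp
  then show "q = 0" using \<kappa>_nonzero by (simp add: c_def)
qed

text \<open>For uniqueness, subtract a multiple of \<open>\<phi> m\<close> to lower the degree below
  \<open>m\<close>, then apply nondegeneracy.\<close>

lemma orthogonal_family_\<phi>: "orthogonal_family w 0 \<phi>"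
proof
  fix q m assume q: "degree q \<le> m" and orth: "\<And>r. degree r < m \<Longrightarrow> moment w (m + 0) (q * r) = 0"
  define c where "c = coeff q m / \<kappa> m"
  define p where "p = q - Polynomial.smult c (\<phi> m)"
  have "coeff p m = 0" using \<kappa>_nonzero by (simp add: p_def c_def lead_coeff)
  moreover have "degree p \<le> m"
    using degree_diff_le_max[of q "Polynomial.smult c (\<phi> m)"] degree_smult_le[of c "\<phi> m"] degree(1)[of m] q
    by (simp add: p_def)
  ultimately have "p = 0 \<or> degree p < m" by (metis leading_coeff_0_iff le_neq_implies_less)
  moreover have "moment w m (p * r) = 0" if "degree r < m" for r
    using orth[OF that] moment_\<phi>[OF that]
    by (simp add: p_def left_diff_distrib moment_diff[OF weight] moment_smult)
  ultimately have "p = 0" using zero_if_orthogonal by blast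
  then show "\<exists>c. q = Polynomial.smult c (\<phi> m)" by (auto simp: p_def)
qed (simp_all add: weight degree coeff_0 moment_\<phi>)

text \<open>For uniqueness, remove the constant term instead of the leading one. Division by the
  variable then lowers both degree and exponent by one, which leads back to the same
  nondegeneracy.\<close>

lemma orthogonal_family_reflect: "orthogonal_family w 1 (\<lambda>m. reflect_poly (\<phi>b m))"
proof
  fix m :: nat and r :: "complex poly" assume "degree r < m"
  then show "moment w (m + 1) (reflect_poly (\<phi>b m) * r) = 0"
    using moment_reflect_eq_pairing[of m r] pairing_zero(2) by simp
next
  fix q m assume q: "degree q \<le> m" and orth: "\<And>r. degree r < m \<Longrightarrow> moment w (m + 1) (q * r) = 0"
  let ?\<psi> = "reflect_poly (\<phi>b m)"
  define c where "c = coeff q 0 / \<kappa> m"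
  define p where "p = q - Polynomial.smult c ?\<psi>"
  define p' where "p' = synthetic_div p 0"
  have "poly p 0 = 0"
    using \<kappa>_nonzero[of m] degree(2)[of m] lead_coeff(2)[of m] by (simp add: p_def c_def poly_0_coeff_0)
  with synthetic_div_correct[of p 0] have p': "p = monom 1 1 * p'"
    by (simp add: p'_def monom_altdef)
  have degp: "degree p \<le> m"
    using degree_diff_le_max[of q "Polynomial.smult c ?\<psi>"] degree_smult_le[of c ?\<psi>]
      degree_reflect_poly_le[of "\<phi>b m"] degree(2)[of m] q
    by (simp add: p_def)
  have "moment w m (p' * r) = 0" if r: "degree r < m" for r
  proof -
    have "moment w m (p' * r) = moment w (m + 1) (p * r)"
      unfolding p' mult.assoc by (rule moment_monom_mult[symmetric])
    also have "\<dots> = 0"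
      using orth[OF r] moment_reflect_eq_pairing[of m r] pairing_zero(2)[OF r]
      by (simp add: p_def left_diff_distrib moment_diff[OF weight] moment_smult)
    finally show ?thesis .
  qed
  moreover have "p' = 0 \<or> degree p' < m"
    using degp by (cases "degree p = 0") (auto simp: p'_def degree_synthetic_div synthetic_div_eq_0_iff)
  ultimately have "p' = 0" using zero_if_orthogonal by blast
  then have "p = 0" by (simp add: p')
  then show "\<exists>c. q = Polynomial.smult c ?\<psi>" by (auto simp: p_def)
qed (use weight degree coeff_0 \<kappa>_nonzero lead_coeff in simp_all)

section \<open>Associated functions as Cauchy transforms\<close>

lemma assoc_fun_eq:
  assumes z: "norm z \<noteq> 1"
  shows "assoc_fun w \<kappa> \<phi> m z = 2 * z ^ m * cauchy w m (\<phi> m) z"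
proof -
  interpret fam: orthogonal_family w 0 \<phi> by (rule orthogonal_family_\<phi>)
  have herglotz: "herglotz (\<lambda>\<zeta>. w \<zeta> * poly p \<zeta>) z = 2 * cauchy w 0 p z - moment w 1 p" for p
  proof -
    have eq: "(\<zeta> + z) / (\<zeta> - z) * (w \<zeta> * poly p \<zeta>)
        = w \<zeta> * (2 * (poly p \<zeta> * \<zeta> / (\<zeta> ^ 0 * (\<zeta> - z))) + (-1) * (poly p \<zeta> * \<zeta> / \<zeta> ^ 1))"
      if "norm \<zeta> = 1" for \<zeta>
    proof -
      have "\<zeta> \<noteq> z" "\<zeta> \<noteq> 0" using that z by auto
      then show ?thesis by (simp add: field_simps)
    qed
    have "herglotz (\<lambda>\<zeta>. w \<zeta> * poly p \<zeta>) z
        = wint w (\<lambda>\<zeta>. 2 * (poly p \<zeta> * \<zeta> / (\<zeta> ^ 0 * (\<zeta> - z))) + (-1) * (poly p \<zeta> * \<zeta> / \<zeta> ^ 1))"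
      \<comment> \<open>A bare \<open>circ_int\<close> is read as \<open>wint\<close> with constant
        weight 1, so that \<open>wint_cong\<close> applies.\<close>
      unfolding herglotz_def wint_def[of "\<lambda>_. 1", simplified, symmetric]
      by (rule wint_cong) (simp only: eq mult_1)
    also have "\<dots> = 2 * cauchy w 0 p z + (-1) * moment w 1 p"
      unfolding cauchy_def moment_def wint_cmult[symmetric]
      by (intro wint_add weight continuous_on_mult continuous_on_const continuous_on_cauchy z continuous_on_moment)
    finally show ?thesis by simp
  qed
  show ?thesis
  proof (cases "m = 0")
    \<comment> \<open>The term \<open>fourier_coeff w 0\<close> in the definition for index 0
      cancels the moment produced by the kernel splitting, so one formula covers all
      \<open>m\<close>.\<close>
    case True
    have \<phi>0: "\<phi> 0 = [:\<kappa> 0:]"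
      using degree(1)[of 0] lead_coeff(1)[of 0] by (metis degree_0_id)
    have "fourier_coeff w 0 = moment w 1 1"
      unfolding fourier_coeff_def moment_def wint_def[of "\<lambda>_. 1", simplified, symmetric]
      by (rule wint_cong) auto
    moreover have "herglotz w z = 2 * cauchy w 0 1 z - moment w 1 1"
      using herglotz[of 1] by simp
    moreover have "cauchy w 0 (\<phi> 0) z = \<kappa> 0 * cauchy w 0 1 z"
      unfolding \<phi>0 cauchy_smult[symmetric] by simp
    ultimately show ?thesis using True by (simp add: assoc_fun_def)
  next
    case False
    \<comment> \<open>For positive \<open>m\<close> the extra moment vanishes by orthogonality to
      the power \<open>m - 1\<close>.\<close>
    have "moment w 1 (\<phi> m) = moment w (1 + (m - 1)) (monom 1 (m - 1) * \<phi> m)"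
      by (rule moment_monom_mult[symmetric])
    also have "\<dots> = moment w m (\<phi> m * monom 1 (m - 1))" using False by (simp add: mult.commute)
    also have "\<dots> = 0" using False by (intro moment_\<phi>) (simp add: degree_monom_eq)
    finally have 1: "moment w 1 (\<phi> m) = 0" .
    have "cauchy w 0 (\<phi> m) z = cauchy w (0 + m) (monom 1 m * \<phi> m) z"
      by (rule cauchy_monom_mult[symmetric])
    also have "\<dots> = cauchy w m (\<phi> m * monom 1 m) z" by (simp add: mult.commute)
    also have "\<dots> = z ^ m * cauchy w m (\<phi> m) z"
      using fam.moment_synthetic_div[of "monom 1 m" m z]
      by (simp add: cauchy_mult[OF weight z] poly_monom degree_monom_eq)
    finally show ?thesis using False 1 by (simp add: assoc_fun_def herglotz)
  qed
qed

text \<open>Here the kernel is split as 1 + 2 z / (\<zeta> - z), whence the additional power of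
  \<open>z\<close>. The moment from the constant 1 vanishes for positive \<open>m\<close> and
  cancels against \<open>fourier_coeff w 0\<close> for \<open>m = 0\<close>.\<close>

lemma assoc_recip_fun_eq:
  assumes z: "norm z \<noteq> 1"
  shows "assoc_recip_fun w \<kappa> \<phi>b m z
    = - 2 * z ^ (m + 1) * cauchy w (m + 1) (reflect_poly (\<phi>b m)) z"
proof -
  let ?\<psi> = "reflect_poly (\<phi>b m)"
  have herglotz: "herglotz (\<lambda>\<zeta>. w \<zeta> * poly (\<phi>b m) (1 / \<zeta>)) z
    = moment w (m + 1) ?\<psi> + 2 * z * cauchy w (m + 1) ?\<psi> z"
  proof -
    have eq: "(\<zeta> + z) / (\<zeta> - z) * (w \<zeta> * poly (\<phi>b m) (1 / \<zeta>))
        = w \<zeta> * (poly ?\<psi> \<zeta> * \<zeta> / \<zeta> ^ (m + 1) + 2 * z * (poly ?\<psi> \<zeta> * \<zeta> / (\<zeta> ^ (m + 1) * (\<zeta> - z))))"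
      if "norm \<zeta> = 1" for \<zeta>
    proof -
      have nz: "\<zeta> - z \<noteq> 0" "\<zeta> \<noteq> 0" using that z by auto
      have "poly ?\<psi> \<zeta> * \<zeta> / \<zeta> ^ (m + 1) = poly (\<phi>b m) (1 / \<zeta>)"
        using nz degree(2)[of m] by (simp add: poly_reflect_poly_nz inverse_eq_divide)
      moreover have "poly ?\<psi> \<zeta> * \<zeta> / (\<zeta> ^ (m + 1) * (\<zeta> - z)) = poly ?\<psi> \<zeta> * \<zeta> / \<zeta> ^ (m + 1) / (\<zeta> - z)"
        by simp
      moreover have "(\<zeta> + z) / (\<zeta> - z) = 1 + 2 * z / (\<zeta> - z)"
        using nz(1) by (simp add: field_simps)
      ultimately show ?thesis by (simp only:) (simp add: algebra_simps)
    qed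
    have "herglotz (\<lambda>\<zeta>. w \<zeta> * poly (\<phi>b m) (1 / \<zeta>)) z
        = wint w (\<lambda>\<zeta>. poly ?\<psi> \<zeta> * \<zeta> / \<zeta> ^ (m + 1) + 2 * z * (poly ?\<psi> \<zeta> * \<zeta> / (\<zeta> ^ (m + 1) * (\<zeta> - z))))"
      unfolding herglotz_def wint_def[of "\<lambda>_. 1", simplified, symmetric]
      by (rule wint_cong) (simp only: eq mult_1)
    also have "\<dots> = moment w (m + 1) ?\<psi> + 2 * z * cauchy w (m + 1) ?\<psi> z"
      unfolding cauchy_def moment_def wint_cmult[symmetric]
      by (intro wint_add weight continuous_on_mult continuous_on_const continuous_on_cauchy z continuous_on_moment)
    finally show ?thesis .
  qed
  show ?thesis
  proof (cases "m = 0")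
    case True
    have \<phi>b0: "\<phi>b 0 = [:\<kappa> 0:]"
      using degree(2)[of 0] lead_coeff(2)[of 0] by (metis degree_0_id)
    have "fourier_coeff w 0 = moment w 1 1"
      unfolding fourier_coeff_def moment_def wint_def[of "\<lambda>_. 1", simplified, symmetric]
      by (rule wint_cong) auto
    moreover have "moment w 1 [:\<kappa> 0:] = \<kappa> 0 * moment w 1 1"
      unfolding moment_smult[symmetric] by simp
    moreover have "\<kappa> 0 * herglotz w z = herglotz (\<lambda>\<zeta>. w \<zeta> * \<kappa> 0) z"
      unfolding herglotz_def wint_def[of "\<lambda>_. 1", simplified, symmetric] wint_cmult[symmetric]
      by (simp add: mult_ac)
    ultimately show ?thesis using True herglotz \<phi>b0 by (simp add: assoc_recip_fun_def algebra_simps)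
  next
    case False
    have "moment w (m + 1) ?\<psi> = 0"
      using moment_reflect_eq_pairing[of m 1] pairing_zero(2)[of 1 m] False by simp
    then show ?thesis using False by (simp add: assoc_recip_fun_def herglotz)
  qed
qed

end

section \<open>The four determinant formulas for the modified weight\<close>

theorem corollary3p1:
  fixes w :: "complex \<Rightarrow> complex"
    and \<kappa> \<kappa>h :: "nat \<Rightarrow> complex"
    and \<phi> \<phi>b \<Phi> \<Phi>b :: "nat \<Rightarrow> complex poly"
    and K L n :: nat
    and \<alpha> \<beta> :: "nat \<Rightarrow> complex"
  defines "wh \<equiv> modified_weight K L \<alpha> \<beta> w"
  defines "\<xi> \<equiv> assoc_fun w \<kappa> \<phi>"
    and "\<xi>s \<equiv> assoc_recip_fun w \<kappa> \<phi>b"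
    and "\<Xi> \<equiv> assoc_fun wh \<kappa>h \<Phi>"
    and "\<Xi>s \<equiv> assoc_recip_fun wh \<kappa>h \<Phi>b"
  assumes "weight w"
    and "inj_on \<alpha> {1..K}"
    and "inj_on \<beta> {1..L}"
    and "\<And>j. j \<in> {1..L} \<Longrightarrow> \<beta> j \<noteq> 0 \<and> \<beta> j \<notin> sphere 0 1"
    and "biorthogonal_system w \<kappa> \<phi> \<phi>b" and "generic_system \<kappa> \<phi> \<phi>b"
    and "biorthogonal_system wh \<kappa>h \<Phi> \<Phi>b" and "generic_system \<kappa>h \<Phi> \<Phi>b"
    and "n \<ge> L"
  shows "\<exists>C Cs.
    (\<forall>z. (\<Prod>j=1..K. z - \<alpha> j) * poly_fun \<Phi> n z
           = C * row_det K L n \<alpha> \<beta> (poly_fun \<phi>) \<xi> (poly_fun \<phi>) z) \<and>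
    (\<forall>z. (\<Prod>j=1..K. z - \<alpha> j) * recip_fun \<Phi>b n z
           = Cs * row_det K L n \<alpha> \<beta> (recip_fun \<phi>b) \<xi>s (recip_fun \<phi>b) z) \<and>
    (\<forall>z. z \<notin> sphere 0 1 \<longrightarrow>
         (\<Prod>j=1..L. z - \<beta> j) * \<Xi> n z
           = C * row_det K L n \<alpha> \<beta> (poly_fun \<phi>) \<xi> \<xi> z) \<and>
    (\<forall>z. z \<notin> sphere 0 1 \<longrightarrow>
         (\<Prod>j=1..L. z - \<beta> j) * \<Xi>s n z
           = Cs * row_det K L n \<alpha> \<beta> (recip_fun \<phi>b) \<xi>s \<xi>s z)"
proof -
  note inj = assms(7,8) and \<beta> = assms(9)
  have Q0: "(\<Prod>j=1..L. \<zeta> - \<beta> j) \<noteq> 0" if "norm \<zeta> = 1" for \<zeta>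
    using \<beta> that by (force simp: prod_zero_iff)
  \<comment> \<open>With all poles off the circle the modifying factor is continuous there, so the
    modified function is again a weight.\<close>
  have "continuous_on (sphere 0 1) (\<lambda>\<zeta>. (\<Prod>j=1..K. \<zeta> - \<alpha> j) / (\<Prod>j=1..L. \<zeta> - \<beta> j))"
    using Q0 by (intro continuous_intros) auto
  from weight_mult[OF assms(6) this] have "weight wh"
    by (simp add: wh_def modified_weight_def[abs_def] mult.commute)
  interpret biorthogonal w \<kappa> \<phi> \<phi>b
    by unfold_locales fact+
  interpret hat: biorthogonal wh \<kappa>h \<Phi> \<Phi>b
    by unfold_locales fact+
  have transfer: "w \<zeta> * poly (\<Prod>j=1..K. [:- \<alpha> j, 1:]) \<zeta> = wh \<zeta> * poly (\<Prod>j=1..L. [:- \<beta> j, 1:]) \<zeta>"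
    if "norm \<zeta> = 1" for \<zeta>
    using Q0[OF that] by (simp add: wh_def modified_weight_def poly_prod)
  have \<beta>': "\<beta> j \<noteq> 0 \<and> norm (\<beta> j) \<noteq> 1" if "j \<in> {1..L}" for j
    using \<beta>[OF that] by simp
  have recip: "recip_fun \<phi>b = poly_fun (\<lambda>m. reflect_poly (\<phi>b m))"
    by (simp add: fun_eq_iff recip_fun_def poly_fun_def)
  obtain C where
    "\<And>z. (\<Prod>j=1..K. z - \<alpha> j) * poly (\<Phi> n) z = C * row_det K L n \<alpha> \<beta> (poly_fun \<phi>) \<xi> (poly_fun \<phi>) z"
    "\<And>z. norm z \<noteq> 1 \<Longrightarrow> (\<Prod>j=1..L. z - \<beta> j) * \<Xi> n z = C * row_det K L n \<alpha> \<beta> (poly_fun \<phi>) \<xi> \<xi> z"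
    using row_det_formula[OF orthogonal_family_\<phi> hat.orthogonal_family_\<phi> transfer inj \<beta>' \<open>n \<ge> L\<close>, of 2 \<xi> \<Xi>]
      assoc_fun_eq hat.assoc_fun_eq by (auto simp: \<xi>_def \<Xi>_def)
  moreover obtain Cs where
    "\<And>z. (\<Prod>j=1..K. z - \<alpha> j) * poly (reflect_poly (\<Phi>b n)) z
      = Cs * row_det K L n \<alpha> \<beta> (recip_fun \<phi>b) \<xi>s (recip_fun \<phi>b) z"
    "\<And>z. norm z \<noteq> 1 \<Longrightarrow> (\<Prod>j=1..L. z - \<beta> j) * \<Xi>s n z = Cs * row_det K L n \<alpha> \<beta> (recip_fun \<phi>b) \<xi>s \<xi>s z"
    using row_det_formula[OF orthogonal_family_reflect hat.orthogonal_family_reflect transfer inj \<beta>' \<open>n \<ge> L\<close>, of "-2" \<xi>s \<Xi>s]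
      assoc_recip_fun_eq hat.assoc_recip_fun_eq by (auto simp: \<xi>s_def \<Xi>s_def recip)
  ultimately show ?thesis
    by (intro exI[of _ C] exI[of _ Cs]) (simp add: poly_fun_def[of \<Phi>] recip_fun_def[of \<Phi>b])
qed

end
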